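(* Let $\varphi$ be a Boolean formula over the finite set of Boolean variables $\Sigma$ and let $\ell$ be a literal of a variable in $\Sigma$. Then $M(\varphi)\subseteq M(\exists \ell\cdot\varphi)$. Moreover, for every world $\omega$: $\omega\in M(\exists \ell\cdot\varphi)$ and $\omega\notin M(\varphi)$ if and only if $\omega$ is an $\bar{\ell}$-boundary model of $\neg\varphi$.
   Context: $\Sigma$ is a fixed finite set of Boolean variables. A literal of variable $X$ is $x$ (positive) or $\bar{x}$ (negative); $\bar{\ell}$ denotes the complement of literal $\ell$. A world $\omega$ is a truth assignment to $\Sigma$, identified with the set of literals (exactly one per variable) that it makes true. $M(\varphi)$ is the set of models (satisfying worlds) of $\varphi$. $\omega[\ell]$ is the world obtained from $\omega$ by replacing its literal of the variable of $\ell$ by $\ell$. A world $\omega$ is an $\ell$-boundary model of a formula $\psi$ iff $\ell\in\omega$, $\omega\models\psi$ and $\omega[\bar{\ell}]\models\neg\psi$. Conditioning: $\varphi|x$ (resp. $\varphi|\bar{x}$) is obtained by replacing every occurrence of variable $X$ in $\varphi$ with true (resp. false). Existential literal quantification is defined by $\exists \ell\cdot\varphi=(\varphi|\ell)\vee(\bar{\ell}\wedge(\varphi|\bar{\ell}))$. *)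

theory Defs
  imports Main
begin

datatype 'v literal = Pos (lit_var: 'v) | Neg (lit_var: 'v)

fun compl_lit :: "'v literal \<Rightarrow> 'v literal" where
  "compl_lit (Pos X) = Neg X"
| "compl_lit (Neg X) = Pos X"

datatype (vars: 'v) formula =
    FTrue
  | FFalse
  | FVar 'v
  | FNot "'v formula"
  | FAnd "'v formula" "'v formula"
  | FOr "'v formula" "'v formula"
  | FImp "'v formula" "'v formula"
  | FIff "'v formula" "'v formula"

fun lit_formula :: "'v literal \<Rightarrow> 'v formula" where
  "lit_formula (Pos X) = FVar X"
| "lit_formula (Neg X) = FNot (FVar X)"

text \<open>A world over \<open>\<Sigma>\<close> is the set of literals it makes true: only literals of variables in
  \<open>\<Sigma>\<close>, and exactly one per variable.\<close>

definition worlds :: "'v set \<Rightarrow> 'v literal set set" where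
  "worlds \<Sigma> = {\<omega>. lit_var ` \<omega> \<subseteq> \<Sigma> \<and> (\<forall>X\<in>\<Sigma>. \<exists>!k. k \<in> \<omega> \<and> lit_var k = X)}"

text \<open>The clause for variables is the intended one when \<open>\<omega>\<close> is a world over a set containing
  the variables of the formula.\<close>

fun satisfies :: "'v literal set \<Rightarrow> 'v formula \<Rightarrow> bool"  (infix \<open>\<Turnstile>\<close> 50) where
  "\<omega> \<Turnstile> FTrue \<longleftrightarrow> True"
| "\<omega> \<Turnstile> FFalse \<longleftrightarrow> False"
| "\<omega> \<Turnstile> FVar X \<longleftrightarrow> Pos X \<in> \<omega>"
| "\<omega> \<Turnstile> FNot \<phi> \<longleftrightarrow> \<not> \<omega> \<Turnstile> \<phi>"
| "\<omega> \<Turnstile> FAnd \<phi> \<psi> \<longleftrightarrow> \<omega> \<Turnstile> \<phi> \<and> \<omega> \<Turnstile> \<psi>"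
| "\<omega> \<Turnstile> FOr \<phi> \<psi> \<longleftrightarrow> \<omega> \<Turnstile> \<phi> \<or> \<omega> \<Turnstile> \<psi>"
| "\<omega> \<Turnstile> FImp \<phi> \<psi> \<longleftrightarrow> (\<omega> \<Turnstile> \<phi> \<longrightarrow> \<omega> \<Turnstile> \<psi>)"
| "\<omega> \<Turnstile> FIff \<phi> \<psi> \<longleftrightarrow> (\<omega> \<Turnstile> \<phi> \<longleftrightarrow> \<omega> \<Turnstile> \<psi>)"

definition models :: "'v set \<Rightarrow> 'v formula \<Rightarrow> 'v literal set set" where
  "models \<Sigma> \<phi> = {\<omega> \<in> worlds \<Sigma>. \<omega> \<Turnstile> \<phi>}"

definition set_lit :: "'v literal set \<Rightarrow> 'v literal \<Rightarrow> 'v literal set" where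
  "set_lit \<omega> l = insert l {k \<in> \<omega>. lit_var k \<noteq> lit_var l}"

definition boundary_model :: "'v literal \<Rightarrow> 'v literal set \<Rightarrow> 'v formula \<Rightarrow> bool" where
  "boundary_model l \<omega> \<psi> \<longleftrightarrow>
     l \<in> \<omega> \<and> \<omega> \<Turnstile> \<psi> \<and> set_lit \<omega> (compl_lit l) \<Turnstile> FNot \<psi>"

fun subst_var :: "'v \<Rightarrow> 'v formula \<Rightarrow> 'v formula \<Rightarrow> 'v formula" where
  "subst_var X \<theta> FTrue = FTrue"
| "subst_var X \<theta> FFalse = FFalse"
| "subst_var X \<theta> (FVar Y) = (if Y = X then \<theta> else FVar Y)"
| "subst_var X \<theta> (FNot \<phi>) = FNot (subst_var X \<theta> \<phi>)"
| "subst_var X \<theta> (FAnd \<phi> \<psi>) = FAnd (subst_var X \<theta> \<phi>) (subst_var X \<theta> \<psi>)"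
| "subst_var X \<theta> (FOr \<phi> \<psi>) = FOr (subst_var X \<theta> \<phi>) (subst_var X \<theta> \<psi>)"
| "subst_var X \<theta> (FImp \<phi> \<psi>) = FImp (subst_var X \<theta> \<phi>) (subst_var X \<theta> \<psi>)"
| "subst_var X \<theta> (FIff \<phi> \<psi>) = FIff (subst_var X \<theta> \<phi>) (subst_var X \<theta> \<psi>)"

fun condition :: "'v formula \<Rightarrow> 'v literal \<Rightarrow> 'v formula" where
  "condition \<phi> (Pos X) = subst_var X FTrue \<phi>"
| "condition \<phi> (Neg X) = subst_var X FFalse \<phi>"

definition exists_lit :: "'v literal \<Rightarrow> 'v formula \<Rightarrow> 'v formula" where
  "exists_lit l \<phi> =
     FOr (condition \<phi> l) (FAnd (lit_formula (compl_lit l)) (condition \<phi> (compl_lit l)))"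

end

theory Submission
  imports Defs
begin

lemma satisfies_condition: "\<omega> \<Turnstile> condition \<phi> l \<longleftrightarrow> set_lit \<omega> l \<Turnstile> \<phi>"
proof (cases l)
  case (Pos X)
  have "\<omega> \<Turnstile> subst_var X FTrue \<phi> \<longleftrightarrow> set_lit \<omega> (Pos X) \<Turnstile> \<phi>"
    \<comment> \<open>The case that matters is \<open>FVar X\<close>: \<open>set_lit\<close> inserts
      \<open>Pos X\<close> and keeps the literals of all other variables.\<close>
    by (induction \<phi>) (auto simp: set_lit_def)
  with Pos show ?thesis by simp
next
  case (Neg X)
  have "\<omega> \<Turnstile> subst_var X FFalse \<phi> \<longleftrightarrow> set_lit \<omega> (Neg X) \<Turnstile> \<phi>"
    by (induction \<phi>) (auto simp: set_lit_def)
  with Neg show ?thesis by simp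
qed

lemma compl_compl_lit [simp]: "compl_lit (compl_lit l) = l"
  by (cases l) simp_all

lemma lit_var_compl_lit [simp]: "lit_var (compl_lit l) = lit_var l"
  by (cases l) simp_all

lemma lit_var_eq_iff: "lit_var k = lit_var l \<longleftrightarrow> k = l \<or> k = compl_lit l"
  by (cases k; cases l) auto

lemma compl_lit_neq: "compl_lit l \<noteq> l"
  by (cases l) simp_all

lemma world_unique_lit:
  assumes "\<omega> \<in> worlds \<Sigma>" "lit_var l \<in> \<Sigma>"
  shows "\<exists>!k. k \<in> \<omega> \<and> lit_var k = lit_var l"
  using assms by (simp add: worlds_def)

lemma compl_lit_in_world_iff:
  assumes "\<omega> \<in> worlds \<Sigma>" "lit_var l \<in> \<Sigma>"
  shows "compl_lit l \<in> \<omega> \<longleftrightarrow> l \<notin> \<omega>"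
  using world_unique_lit[OF assms] compl_lit_neq[of l] unfolding lit_var_eq_iff by blast

text \<open>\<open>satisfies\<close> consults positive literals only, so for \<open>Neg X\<close>
  the absence of \<open>Pos X\<close> must be turned into the presence of
  \<open>Neg X\<close>.\<close>

lemma satisfies_lit_formula:
  assumes "\<omega> \<in> worlds \<Sigma>" "lit_var l \<in> \<Sigma>"
  shows "\<omega> \<Turnstile> lit_formula l \<longleftrightarrow> l \<in> \<omega>"
  using compl_lit_in_world_iff[OF assms] by (cases l) auto

lemma set_lit_same:
  assumes "\<omega> \<in> worlds \<Sigma>" "lit_var l \<in> \<Sigma>" "l \<in> \<omega>"
  shows "set_lit \<omega> l = \<omega>"
  using compl_lit_in_world_iff[OF assms(1,2)] assms(3)
  by (auto simp: set_lit_def lit_var_eq_iff)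

lemma satisfies_exists_lit:
  assumes "\<omega> \<in> worlds \<Sigma>" "lit_var l \<in> \<Sigma>"
  shows "\<omega> \<Turnstile> exists_lit l \<phi> \<longleftrightarrow> \<omega> \<Turnstile> \<phi> \<or> compl_lit l \<in> \<omega> \<and> set_lit \<omega> l \<Turnstile> \<phi>"
proof -
  have *: "lit_var (compl_lit l) \<in> \<Sigma>"
    using assms(2) by simp
  show ?thesis
    unfolding exists_lit_def
    \<comment> \<open>Exactly one of \<open>l\<close> and its complement is in
      \<open>\<omega>\<close>, and setting that one leaves \<open>\<omega>\<close> fixed. This
      reduces one disjunct to \<open>\<omega> \<Turnstile> \<phi>\<close>.\<close>
    using compl_lit_in_world_iff[OF assms] set_lit_same[OF assms] set_lit_same[OF assms(1) *]
    by (auto simp: satisfies_condition satisfies_lit_formula[OF assms(1) *])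
qed

theorem theorem6:
  fixes \<Sigma> :: "'v set" and \<phi> :: "'v formula" and l :: "'v literal"
  assumes "finite \<Sigma>"
    and "vars \<phi> \<subseteq> \<Sigma>"
    and "lit_var l \<in> \<Sigma>"
  shows "models \<Sigma> \<phi> \<subseteq> models \<Sigma> (exists_lit l \<phi>) \<and>
    (\<forall>\<omega> \<in> worlds \<Sigma>.
       (\<omega> \<in> models \<Sigma> (exists_lit l \<phi>) \<and> \<omega> \<notin> models \<Sigma> \<phi>) \<longleftrightarrow>
       boundary_model (compl_lit l) \<omega> (FNot \<phi>))"
  \<comment> \<open>The double complement and the double negation in the boundary condition cancel,
    leaving \<open>set_lit \<omega> l \<Turnstile> \<phi>\<close>.\<close>
  using assms(3) by (auto simp: models_def boundary_model_def satisfies_exists_lit)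

end
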